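(* Let $n,k$ be positive integers, $m$ a natural number, and let $Q_0,Q_i\in\mathcal S^n$, $B_0,B_i\in\mathbb R^{n\times k}$, $d_0,d_i\in\mathbb R$ for $i\in[m]$. Consider the binary quadratic matrix program in the variable $P$ $$(QMP_2)\quad \min\;\operatorname{tr}(P^\top Q_0P)+2\operatorname{tr}(B_0^\top P)+d_0\quad\text{s.t.}\quad \operatorname{tr}(P^\top Q_iP)+2\operatorname{tr}(B_i^\top P)+d_i\le 0\ \ \forall i\in[m],\quad P\mathbf 1_k\le\mathbf 1_n,\quad P\in\{0,1\}^{n\times k},$$ and the binary semidefinite program in the variables $P$, $X$ $$(BSDP_{QMP2})\quad \min\;\left\langle\begin{pmatrix}\frac{d_0}{k}\mathbf I_k&B_0^\top\\ B_0&Q_0\end{pmatrix},\begin{pmatrix}\mathbf I_k&P^\top\\ P&X\end{pmatrix}\right\rangle\quad\text{s.t.}\quad \left\langle\begin{pmatrix}\frac{d_i}{k}\mathbf I_k&B_i^\top\\ B_i&Q_i\end{pmatrix},\begin{pmatrix}\mathbf I_k&P^\top\\ P&X\end{pmatrix}\right\rangle\le 0\ \ \forall i\in[m],$$ $$\begin{pmatrix}\mathbf I_k&P^\top\\ P&X\end{pmatrix}\succeq\mathbf 0,\quad \operatorname{diag}(X)=P\mathbf 1_k,\quad X\in\{0,1\}^{n\times n},\quad P\in\{0,1\}^{n\times k}.$$ Then $(BSDP_{QMP2})$ is equivalent to $(QMP_2)$.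
   Context: $[m]=\{1,\dots,m\}$; $\mathcal S^n$ is the set of real symmetric $n\times n$ matrices; $\mathbf 1_n$ is the all-ones vector in $\mathbb R^n$; $\mathbf I_k$ is the identity matrix of order $k$; $\langle X,Y\rangle=\operatorname{tr}(X^\top Y)$; $X\succeq\mathbf 0$ means $X$ is (symmetric) positive semidefinite; $\operatorname{diag}(X)$ is the vector of diagonal entries; vector inequalities are entrywise. Two optimization problems are called equivalent if every feasible solution of either one yields a feasible solution of the other with the same objective value. *)

theory Defs
  imports "HOL-Analysis.Analysis"
begin

text \<open>
  An \<open>n \<times> k\<close> real matrix has type \<open>real^'k^'n\<close> with \<open>n = CARD('n)\<close>, \<open>k = CARD('k)\<close>;
  \<open>n\<close> and \<open>k\<close> are positive because every type is nonempty.
\<close>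

record 'a min_problem =
  feasible :: "'a set"
  objective :: "'a \<Rightarrow> real"

definition equivalent_problems :: "'a min_problem \<Rightarrow> 'b min_problem \<Rightarrow> bool" where
  "equivalent_problems p q \<longleftrightarrow>
     (\<forall>x \<in> feasible p. \<exists>y \<in> feasible q. objective q y = objective p x) \<and>
     (\<forall>y \<in> feasible q. \<exists>x \<in> feasible p. objective p x = objective q y)"

definition symmetric_matrix :: "real^'n^'n \<Rightarrow> bool" where
  "symmetric_matrix A \<longleftrightarrow> transpose A = A"

definition psd :: "real^'n^'n \<Rightarrow> bool" where
  "psd A \<longleftrightarrow> symmetric_matrix A \<and> (\<forall>v. 0 \<le> v \<bullet> (A *v v))"

definition frob_inner :: "real^'n^'m \<Rightarrow> real^'n^'m \<Rightarrow> real" where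
  "frob_inner A B = trace (transpose A ** B)"

definition diag_vec :: "real^'n^'n \<Rightarrow> real^'n" where
  "diag_vec A = (\<chi> i. A $ i $ i)"

definition binary_matrix :: "real^'n^'m \<Rightarrow> bool" where
  "binary_matrix A \<longleftrightarrow> (\<forall>i j. A $ i $ j \<in> {0, 1})"

text \<open>\<open>block_matrix A B C D\<close> has block rows \<open>A B\<close> and \<open>C D\<close>.\<close>

definition block_matrix ::
    "real^'k^'k \<Rightarrow> real^'n^'k \<Rightarrow> real^'k^'n \<Rightarrow> real^'n^'n \<Rightarrow> real^('k + 'n)^('k + 'n)" where
  "block_matrix A B C D = (\<chi> r c.
     case r of
       Inl i \<Rightarrow> (case c of Inl j \<Rightarrow> A $ i $ j | Inr j \<Rightarrow> B $ i $ j)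
     | Inr i \<Rightarrow> (case c of Inl j \<Rightarrow> C $ i $ j | Inr j \<Rightarrow> D $ i $ j))"

definition quad_fun :: "real^'n^'n \<Rightarrow> real^'k^'n \<Rightarrow> real \<Rightarrow> real^'k^'n \<Rightarrow> real" where
  "quad_fun Q B d P = trace (transpose P ** Q ** P) + 2 * trace (transpose B ** P) + d"

definition data_matrix :: "real^'n^'n \<Rightarrow> real^'k^'n \<Rightarrow> real \<Rightarrow> real^('k + 'n)^('k + 'n)" where
  "data_matrix Q B d = block_matrix (mat (d / real CARD('k))) (transpose B) B Q"

definition lifted_matrix :: "real^'k^'n \<Rightarrow> real^'n^'n \<Rightarrow> real^('k + 'n)^('k + 'n)" where
  "lifted_matrix P X = block_matrix (mat 1) (transpose P) P X"

text \<open>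
  The data are families indexed by \<open>nat\<close>: index \<open>0\<close> gives the objective and the indices
  \<open>1, \<dots>, m\<close> the constraints. On vectors, \<open>1\<close> is the all-ones vector and \<open>\<le>\<close> is entrywise.
\<close>

definition QMP2 ::
    "nat \<Rightarrow> (nat \<Rightarrow> real^'n^'n) \<Rightarrow> (nat \<Rightarrow> real^'k^'n) \<Rightarrow> (nat \<Rightarrow> real)
     \<Rightarrow> (real^'k^'n) min_problem" where
  "QMP2 m Q B d =
     \<lparr> feasible = {P. (\<forall>i \<in> {1..m}. quad_fun (Q i) (B i) (d i) P \<le> 0) \<and>
                     P *v 1 \<le> 1 \<and> binary_matrix P},
       objective = quad_fun (Q 0) (B 0) (d 0) \<rparr>"

definition BSDP_QMP2 ::
    "nat \<Rightarrow> (nat \<Rightarrow> real^'n^'n) \<Rightarrow> (nat \<Rightarrow> real^'k^'n) \<Rightarrow> (nat \<Rightarrow> real)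
     \<Rightarrow> ((real^'k^'n) \<times> (real^'n^'n)) min_problem" where
  "BSDP_QMP2 m Q B d =
     \<lparr> feasible = {(P, X).
         (\<forall>i \<in> {1..m}. frob_inner (data_matrix (Q i) (B i) (d i)) (lifted_matrix P X) \<le> 0) \<and>
         psd (lifted_matrix P X) \<and> diag_vec X = P *v 1 \<and> binary_matrix X \<and> binary_matrix P},
       objective = (\<lambda>(P, X). frob_inner (data_matrix (Q 0) (B 0) (d 0)) (lifted_matrix P X)) \<rparr>"

end

theory Submission
  imports Defs
begin

text \<open>
  Testing the semidefinite constraint on the vectors with blocks \<open>- P\<^sup>T w\<close> and \<open>w\<close> shows that it
  says exactly that the Schur complement \<open>X - P P\<^sup>T\<close> is positive semidefinite. Since \<open>P\<close> is
  binary, \<open>diag (P P\<^sup>T) = P 1\<close>, so the constraint \<open>diag X = P 1\<close> makes the diagonal of the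
  Schur complement vanish, and a positive semidefinite matrix with zero diagonal is zero.
  Hence \<open>X = P P\<^sup>T\<close> at every feasible point; then \<open>P 1 = diag X \<le> 1\<close> because \<open>X\<close> is binary,
  and the two objectives and constraints coincide.
\<close>

lemma sum_UNIV_Plus:
  fixes f :: "'a::finite + 'b::finite \<Rightarrow> 'c::comm_monoid_add"
  shows "sum f UNIV = (\<Sum>i\<in>UNIV. f (Inl i)) + (\<Sum>j\<in>UNIV. f (Inr j))"
  by (subst UNIV_Plus_UNIV [symmetric], subst sum.Plus) (auto simp: o_def)

text \<open>Block vectors matching the index type of \<open>block_matrix\<close>; every vector over
  \<open>'k + 'n\<close> has this form, so quadratic forms can be evaluated block by block.\<close>

definition join_vec :: "real^'k \<Rightarrow> real^'n \<Rightarrow> real^('k + 'n)" where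
  "join_vec u w = (\<chi> r. case r of Inl i \<Rightarrow> u $ i | Inr i \<Rightarrow> w $ i)"

lemma join_vec_cases:
  obtains u w where "v = join_vec u w"
proof
  show "v = join_vec (\<chi> i. v $ Inl i) (\<chi> i. v $ Inr i)"
    by (simp add: vec_eq_iff join_vec_def split: sum.split)
qed

lemma inner_join_vec: "join_vec u w \<bullet> join_vec u' w' = u \<bullet> u' + w \<bullet> w'"
  by (simp add: inner_vec_def sum_UNIV_Plus join_vec_def)

lemma block_matrix_mult_join_vec:
  "block_matrix A B C D *v join_vec u w = join_vec (A *v u + B *v w) (C *v u + D *v w)"
  by (simp add: vec_eq_iff matrix_vector_mult_def sum_UNIV_Plus join_vec_def block_matrix_def
      split: sum.split)

lemma transpose_block_matrix:
  "transpose (block_matrix A B C D)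
     = block_matrix (transpose A) (transpose C) (transpose B) (transpose D)"
  by (simp add: vec_eq_iff transpose_def block_matrix_def split: sum.split)

lemma block_matrix_eq_iff:
  "block_matrix A B C D = block_matrix A' B' C' D' \<longleftrightarrow> A = A' \<and> B = B' \<and> C = C' \<and> D = D'"
  (is "?l \<longleftrightarrow> ?r")
proof
  assume eq: ?l
  have "block_matrix A B C D $ r $ c = block_matrix A' B' C' D' $ r $ c" for r c
    using eq by simp
  from this [of "Inl _" "Inl _"] this [of "Inl _" "Inr _"]
    this [of "Inr _" "Inl _"] this [of "Inr _" "Inr _"]
  show ?r by (simp add: block_matrix_def vec_eq_iff)
qed simp

text \<open>Replacing the trace by the entrywise inner product lets it split over the four
  blocks.\<close>

lemma frob_inner_eq_inner: "frob_inner A B = A \<bullet> B"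
  unfolding frob_inner_def trace_def matrix_matrix_mult_def transpose_def inner_vec_def
  by (simp, rule sum.swap)

lemma inner_transpose: "transpose A \<bullet> transpose B = A \<bullet> (B :: real^'n^'m)"
  by (simp add: inner_vec_def transpose_def, rule sum.swap)

lemma inner_block_matrix:
  "block_matrix A B C D \<bullet> block_matrix A' B' C' D' = A \<bullet> A' + B \<bullet> B' + C \<bullet> C' + D \<bullet> D'"
  by (simp add: inner_vec_def sum_UNIV_Plus block_matrix_def sum.distrib)

lemma inner_mat: "mat a \<bullet> (mat b :: real^'k^'k) = real CARD('k) * (a * b)"
  by (simp add: inner_vec_def mat_def if_distrib [of "\<lambda>x. x * _"] sum.delta' cong: if_cong)

text \<open>Transposing under the trace turns \<open>transpose Q\<close> back into \<open>Q\<close>,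
  and cyclicity moves \<open>P\<close> to the end. This is how a term linear in \<open>X\<close>
  becomes quadratic in \<open>P\<close> at \<open>X = P ** transpose P\<close>.\<close>

lemma inner_gram:
  "Q \<bullet> (P ** transpose P) = trace (transpose P ** Q ** (P :: real^'k^'n))"
proof -
  have "Q \<bullet> (P ** transpose P) = trace (transpose Q ** P ** transpose P)"
    by (simp add: frob_inner_eq_inner [symmetric] frob_inner_def matrix_mul_assoc)
  also have "\<dots> = trace (transpose (transpose Q ** P ** transpose P))"
    by (simp add: trace_def transpose_def)
  also have "\<dots> = trace (P ** (transpose P ** Q))"
    by (simp add: matrix_transpose_mul)
  also have "\<dots> = trace (transpose P ** Q ** P)"
    by (rule trace_mul_sym)
  finally show ?thesis .
qed

text \<open>The corner block gives \<open>k * (d / k) = d\<close>, which explains the scaling by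
  \<open>k\<close>; the two off-diagonal blocks give equal traces, hence the factor 2; the last
  block is \<open>inner_gram\<close>.\<close>

lemma frob_inner_lifted_gram:
  "frob_inner (data_matrix Q B d) (lifted_matrix P (P ** transpose P)) = quad_fun Q B d P"
  by (simp add: frob_inner_eq_inner data_matrix_def lifted_matrix_def inner_block_matrix inner_mat
      inner_transpose inner_gram quad_fun_def)
    (simp add: frob_inner_eq_inner [symmetric] frob_inner_def)

text \<open>Completing the square in \<open>u\<close>: the cross terms
  \<open>2 * (u \<bullet> (transpose P *v w))\<close> are absorbed, and what remains is a form in
  \<open>w\<close> alone.\<close>

lemma lifted_matrix_quadratic_form:
  "join_vec u w \<bullet> (lifted_matrix P X *v join_vec u w)
     = (u + transpose P *v w) \<bullet> (u + transpose P *v w) + w \<bullet> ((X - P ** transpose P) *v w)"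
proof -
  have "w \<bullet> (P *v x) = (transpose P *v w) \<bullet> x" for x
    by (simp add: dot_lmul_matrix)
  then show ?thesis
    by (simp add: lifted_matrix_def block_matrix_mult_join_vec inner_join_vec inner_simps
        matrix_vector_mult_diff_rdistrib matrix_vector_mul_assoc [symmetric] inner_commute)
qed

lemma psd_lifted_matrix_iff:
  fixes P :: "real^'k^'n"
  shows "psd (lifted_matrix P X) \<longleftrightarrow> psd (X - P ** transpose P)"
proof -
  \<comment> \<open>\<open>P ** transpose P\<close> is symmetric and the off-diagonal blocks are
    transposes of each other, so both sides amount to symmetry of \<open>X\<close>.\<close>
  have sym: "symmetric_matrix (lifted_matrix P X) \<longleftrightarrow> symmetric_matrix (X - P ** transpose P)"
  proof -
    have "transpose (X - P ** transpose P) = transpose X - P ** transpose P"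
      using matrix_transpose_mul [of P "transpose P"]
      by (simp add: vec_eq_iff transpose_def)
    then show ?thesis
      by (simp add: symmetric_matrix_def lifted_matrix_def transpose_block_matrix
          block_matrix_eq_iff)
  qed
  have "(\<forall>v. 0 \<le> v \<bullet> (lifted_matrix P X *v v)) \<longleftrightarrow> (\<forall>w. 0 \<le> w \<bullet> ((X - P ** transpose P) *v w))"
    (is "?l \<longleftrightarrow> ?r")
  proof
    assume l: ?l
    show ?r
    proof
      fix w
      show "0 \<le> w \<bullet> ((X - P ** transpose P) *v w)"
        using l [rule_format, of "join_vec (- (transpose P *v w)) w"]
        by (simp add: lifted_matrix_quadratic_form)
    qed
  next
    assume r: ?r
    show ?l
    proof
      fix v :: "real^('k + 'n)"
      obtain u w where "v = join_vec u w" by (rule join_vec_cases)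
      \<comment> \<open>The first summand of the decomposition is a squared norm, the second is
        nonnegative by \<open>r\<close>.\<close>
      then show "0 \<le> v \<bullet> (lifted_matrix P X *v v)"
        using r by (simp add: lifted_matrix_quadratic_form)
    qed
  qed
  with sym show ?thesis by (simp add: psd_def)
qed

lemma psd_zero: "psd 0"
  by (simp add: psd_def symmetric_matrix_def transpose_def vec_eq_iff)

lemma axis_inner_matrix_axis: "axis i 1 \<bullet> (A *v axis j 1) = (A $ i $ j :: real)"
  by (simp add: inner_axis' matrix_vector_mul_component inner_axis)

lemma psd_zero_diagonal_eq_zero:
  assumes "psd A" and "\<And>i. A $ i $ i = 0"
  shows "A = 0"
proof -
  have "A $ i $ j = 0" for i j
  proof -
    have "A $ j $ i = A $ i $ j"
      using assms(1) unfolding psd_def symmetric_matrix_def transpose_def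
      by (metis vec_lambda_beta)
    \<comment> \<open>By symmetry and the zero diagonal, these two values are
      \<open>2 * A $ i $ j\<close> and its negative.\<close>
    moreover have "0 \<le> (axis i 1 + axis j 1) \<bullet> (A *v (axis i 1 + axis j 1))"
      and "0 \<le> (axis i 1 - axis j 1) \<bullet> (A *v (axis i 1 - axis j 1))"
      using assms(1) by (auto simp: psd_def)
    ultimately show ?thesis
      by (simp add: matrix_vector_right_distrib matrix_vector_mult_diff_distrib inner_simps
          axis_inner_matrix_axis assms(2))
  qed
  then show ?thesis by (simp add: vec_eq_iff)
qed

text \<open>The numbers 0 and 1 are their own squares, so each row of \<open>P\<close> has squared
  norm equal to its sum.\<close>

lemma diag_vec_gram_binary:
  assumes "binary_matrix P"
  shows "diag_vec (P ** transpose P) = P *v 1"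
proof -
  have "(\<Sum>j\<in>UNIV. P $ i $ j * P $ i $ j) = (\<Sum>j\<in>UNIV. P $ i $ j)" for i
  proof (rule sum.cong [OF refl])
    fix j
    show "P $ i $ j * P $ i $ j = P $ i $ j"
      using assms by (simp add: binary_matrix_def)
  qed
  then show ?thesis
    by (simp add: vec_eq_iff diag_vec_def matrix_matrix_mult_def matrix_vector_mult_def
        transpose_def)
qed

text \<open>Each entry is a nonnegative integer dominated by a row sum of \<open>P\<close>, hence at
  most 1. This makes the lifted \<open>X\<close> admissible.\<close>

lemma binary_matrix_gram:
  assumes "binary_matrix P" and "P *v 1 \<le> 1"
  shows "binary_matrix (P ** transpose P)"
proof -
  have "(P ** transpose P) $ i $ l \<in> {0, 1}" for i l
  proof -
    let ?s = "\<Sum>j\<in>UNIV. P $ i $ j * P $ l $ j"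
    have bin: "P $ a $ j = 0 \<or> P $ a $ j = 1" for a j
      using assms(1) by (auto simp: binary_matrix_def)
    have prod: "P $ i $ j * P $ l $ j \<in> \<int> \<and> 0 \<le> P $ i $ j * P $ l $ j
        \<and> P $ i $ j * P $ l $ j \<le> P $ i $ j" for j
      using bin [of i j] bin [of l j] by auto
    have int: "?s \<in> \<int>" and nonneg: "0 \<le> ?s"
      using prod by (auto intro: Ints_sum sum_nonneg)
    have "?s \<le> (\<Sum>j\<in>UNIV. P $ i $ j)"
      using prod by (intro sum_mono) auto
    also have "\<dots> \<le> 1"
      using assms(2) by (auto simp: less_eq_vec_def matrix_vector_mult_def)
    finally have "?s \<le> 1" .
    with int nonneg have "?s \<in> {0, 1}"
      by (auto elim!: Ints_cases)
    then show ?thesis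
      by (simp add: matrix_matrix_mult_def transpose_def)
  qed
  then show ?thesis by (simp add: binary_matrix_def)
qed

lemma lifted_feasible_iff:
  "psd (lifted_matrix P X) \<and> diag_vec X = P *v 1 \<and> binary_matrix X \<and> binary_matrix P
     \<longleftrightarrow> X = P ** transpose P \<and> P *v 1 \<le> 1 \<and> binary_matrix P" (is "?l \<longleftrightarrow> ?r")
proof
  assume l: ?l
  have "X - P ** transpose P = 0"
  proof (rule psd_zero_diagonal_eq_zero)
    show "psd (X - P ** transpose P)"
      using l psd_lifted_matrix_iff by blast
    have "diag_vec X = diag_vec (P ** transpose P)"
      using l diag_vec_gram_binary by metis
    then show "(X - P ** transpose P) $ i $ i = 0" for i
      by (simp add: diag_vec_def vec_eq_iff)
  qed
  moreover have "diag_vec X \<le> 1"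
  proof -
    have "X $ i $ i \<le> 1" for i
      using l unfolding binary_matrix_def
      by (metis insertE empty_iff order_refl zero_le_one)
    then show ?thesis by (simp add: less_eq_vec_def diag_vec_def)
  qed
  ultimately show ?r using l by simp
next
  assume ?r
  then show ?l
    \<comment> \<open>Here the Schur complement is the zero matrix.\<close>
    by (simp add: psd_lifted_matrix_iff psd_zero diag_vec_gram_binary binary_matrix_gram)
qed

theorem theorem11:
  fixes m :: nat
    and Q :: "nat \<Rightarrow> real^'n^'n"
    and B :: "nat \<Rightarrow> real^'k^'n"
    and d :: "nat \<Rightarrow> real"
  assumes "\<And>i. i \<le> m \<Longrightarrow> symmetric_matrix (Q i)"
  shows "equivalent_problems (BSDP_QMP2 m Q B d) (QMP2 m Q B d)"
proof -
  \<comment> \<open>The feasible set is the graph of \<open>P \<mapsto> P ** transpose P\<close>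
    over that of the quadratic program, so this one map and the projection to \<open>P\<close> serve
    both directions.\<close>
  have "feasible (BSDP_QMP2 m Q B d) = (\<lambda>P. (P, P ** transpose P)) ` feasible (QMP2 m Q B d)"
    unfolding BSDP_QMP2_def QMP2_def lifted_feasible_iff
    by (auto simp: frob_inner_lifted_gram)
  moreover have "objective (BSDP_QMP2 m Q B d) (P, P ** transpose P) = objective (QMP2 m Q B d) P"
    for P
    by (simp add: BSDP_QMP2_def QMP2_def frob_inner_lifted_gram)
  ultimately show ?thesis
    by (auto simp: equivalent_problems_def)
qed

end
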